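(* Let $(a_n)_{n=1}^\infty$ be a non-decreasing sequence of positive integers with $a_1\geqslant 2$ and $a_n\to\infty$. Then there exist $\theta\in(0,1)$ and a sequence of positive integers $(b_n)_{n=1}^\infty$ such that $\sum_{n=1}^\infty\frac1{b_n}=\theta$ and, for every $n\geqslant 1$, $a_n=G\left(\theta-\sum_{i=1}^{n-1}\frac1{b_i}\right)$.
   Context: For $x\in(0,1]$, $G(x)=\lfloor 1/x\rfloor+1$, i.e. the unique integer $a\geqslant 2$ with $\frac1a<x\leqslant\frac{1}{a-1}$. Empty sums are $0$. *)

theory Defs
  imports Complex_Main
begin

(* Meant for 0 < x <= 1; G_eq_iff is the unique-integer description on that domain. *)
definition G :: "real \<Rightarrow> int" where
  "G x = \<lfloor>1 / x\<rfloor> + 1"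

lemma G_eq_iff:
  fixes x :: real and a :: int
  assumes "0 < x" "x \<le> 1"
  shows "G x = a \<longleftrightarrow> a \<ge> 2 \<and> 1 / of_int a < x \<and> x \<le> 1 / (of_int a - 1)"
proof
  assume "G x = a"
  then have f: "\<lfloor>1 / x\<rfloor> = a - 1" by (simp add: G_def)
  have "1 \<le> 1 / x" using assms by simp
  then have "1 \<le> \<lfloor>1 / x\<rfloor>" by simp
  then have a: "a \<ge> 2" using f by simp
  have "of_int a - 1 \<le> 1 / x" "1 / x < of_int a" using f by linarith+
  then show "a \<ge> 2 \<and> 1 / of_int a < x \<and> x \<le> 1 / (of_int a - 1)"
    using a assms by (auto simp: field_simps)
next
  assume h: "a \<ge> 2 \<and> 1 / of_int a < x \<and> x \<le> 1 / (of_int a - 1)"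
  then have "of_int a - 1 > (0::real)" "of_int a > (0::real)" by auto
  then have "of_int a - 1 \<le> 1 / x" "1 / x < of_int a"
    using h assms by (auto simp: field_simps)
  then have "\<lfloor>1 / x\<rfloor> = a - 1" by linarith
  then show "G x = a" by (simp add: G_def)
qed

end

(* Work backwards: the remainders r_n = \<theta> - (1/b_1 + ... + 1/b_(n-1)) satisfy r_n = r_(n+1) + 1/b_n
   and must lie in (1/a_n, 1/(a_n - 1)].  Shrink these intervals to compact ones
   [1/a_n + d_n, 1/(a_n - 1) - d_n] so that every point of the (n+1)-st interval can be moved into
   the n-th one by adding 1/b with b below a bound M_n depending on n only.  If a_n < a_(n+1), the
   least b that keeps r_(n+1) + 1/b below the upper end works; if a_n = a_(n+1), halve d and take b
   large.  This yields finite chains of every length, and since b_n <= M_n, Koenig's lemma gives an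
   infinite one; it sums to \<theta> because the intervals shrink to 0. *)

theory Submission
  imports Defs "HOL-Library.Infinite_Set"
begin

section \<open>Compactness: from finite chains to an infinite series\<close>

text \<open>Pigeonhole, column by column: only finitely many values up to \<open>M n\<close> are
  possible, so an infinite set of rows \<open>N\<close> can be thinned to an infinite subset on
  which column \<open>n\<close> is constant; \<open>g\<close> collects these constants.\<close>

lemma konig_bounded_sequences:
  fixes f :: "nat \<Rightarrow> nat \<Rightarrow> nat"
  assumes bnd: "\<And>N n. f N n \<le> M n"
  obtains g where "\<And>m. infinite {N. \<forall>n<m. f N n = g n}"
proof -
  have step: "\<exists>J. infinite J \<and> J \<subseteq> I \<and> (\<exists>v. \<forall>N\<in>J. f N n = v)" if I: "infinite I" for I n
  proof -
    have "finite ((\<lambda>N. f N n) ` I)"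
      using bnd by (auto intro: finite_subset[of _ "{..M n}"])
    from pigeonhole_infinite[OF I this] obtain N0
      where "N0 \<in> I" "infinite {N \<in> I. f N n = f N0 n}" by blast
    then show ?thesis by (intro exI[of _ "{N \<in> I. f N n = f N0 n}"]) auto
  qed
  have "\<exists>I. \<forall>n. infinite (I n) \<and> (I (Suc n) \<subseteq> I n \<and> (\<exists>v. \<forall>N\<in>I (Suc n). f N n = v))"
  proof (rule dependent_nat_choice)
    show "\<exists>I::nat set. infinite I" using infinite_UNIV_nat by blast
  qed (rule step)
  then obtain I where I: "\<And>n. infinite (I n)" "\<And>n. I (Suc n) \<subseteq> I n"
      "\<And>n. \<exists>v. \<forall>N\<in>I (Suc n). f N n = v" by blast
  obtain g where g: "\<And>n N. N \<in> I (Suc n) \<Longrightarrow> f N n = g n"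
    using I(3) by metis
  have "I m \<subseteq> {N. \<forall>n<m. f N n = g n}" for m
  proof (clarify)
    fix N n assume "N \<in> I m" "n < m"
    moreover have "I m \<subseteq> I (Suc n)"
      using lift_Suc_antimono_le[of I, OF I(2)] \<open>n < m\<close> by simp
    ultimately show "f N n = g n" using g by blast
  qed
  then have "infinite {N. \<forall>n<m. f N n = g n}" for m
    using I(1) by (rule infinite_super)
  then show ?thesis by (rule that)
qed

text \<open>The chain is built from its far end: \<open>x\<close> is the last remainder, and each
  step back adds one unit fraction. New entries go in front, so the induction on \<open>k\<close>
  keeps \<open>n\<close> arbitrary.\<close>

lemma finite_backward_chain:
  fixes lo hi :: "nat \<Rightarrow> real" and M :: "nat \<Rightarrow> nat"
  assumes ne: "\<And>n. lo n \<le> hi n"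
    and step: "\<And>n r. r \<in> {lo (Suc n)..hi (Suc n)} \<Longrightarrow> \<exists>b\<in>{1..M n}. r + 1 / real b \<in> {lo n..hi n}"
  shows "\<exists>b x. (\<forall>i. b i \<le> M i) \<and> (\<forall>i\<in>{n..<n + k}. 1 \<le> b i) \<and> x \<in> {lo (n + k)..hi (n + k)} \<and>
    (\<forall>j\<in>{n..n + k}. x + (\<Sum>i=j..<n + k. 1 / real (b i)) \<in> {lo j..hi j})"
proof (induction k arbitrary: n)
  case 0
  \<comment> \<open>Entries outside the chain default to 0, so the bound \<open>M i\<close> holds at
    every index, as Koenig's lemma requires.\<close>
  show ?case using ne[of n] by (intro exI[of _ "\<lambda>_. 0"] exI[of _ "lo n"]) auto
next
  case (Suc k)
  from Suc.IH[of "Suc n"] obtain b x where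
    b: "\<And>i. b i \<le> M i" "\<And>i. i \<in> {Suc n..<Suc n + k} \<Longrightarrow> 1 \<le> b i"
    and x: "x \<in> {lo (Suc n + k)..hi (Suc n + k)}"
    and S: "\<And>j. j \<in> {Suc n..Suc n + k} \<Longrightarrow> x + (\<Sum>i=j..<Suc n + k. 1 / real (b i)) \<in> {lo j..hi j}"
    by blast
  from step[OF S[of "Suc n"]] obtain v where v: "v \<in> {1..M n}"
    "x + (\<Sum>i=Suc n..<Suc n + k. 1 / real (b i)) + 1 / real v \<in> {lo n..hi n}" by auto
  define b' where "b' = b(n := v)"
  have eq: "(\<Sum>i=j..<Suc n + k. 1 / real (b' i)) = (\<Sum>i=j..<Suc n + k. 1 / real (b i))"
    if "j > n" for j
    using that by (intro sum.cong) (auto simp: b'_def)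
  have "x + (\<Sum>i=j..<Suc n + k. 1 / real (b' i)) \<in> {lo j..hi j}" if j: "j \<in> {n..Suc n + k}" for j
  proof (cases "j = n")
    case True
    have "(\<Sum>i=n..<Suc n + k. 1 / real (b' i)) = 1 / real v + (\<Sum>i=Suc n..<Suc n + k. 1 / real (b i))"
      using eq[of "Suc n"] by (subst sum.atLeast_Suc_lessThan) (auto simp: b'_def)
    then show ?thesis using v True by (simp add: algebra_simps)
  next
    case False
    then show ?thesis using S[of j] eq[of j] j by simp
  qed
  moreover have "b' i \<le> M i" for i using b v by (simp add: b'_def)
  moreover have "1 \<le> b' i" if "i \<in> {n..<Suc n + k}" for i
    using b(2)[of i] v that by (auto simp: b'_def)
  ultimately show ?case using x by (intro exI[of _ b'] exI[of _ x]) simp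
qed

text \<open>Koenig's lemma turns the finite chains into one sequence. Its partial sums inherit the
  interval bounds up to an error \<open>hi m\<close> that tends to 0, and since the intervals are
  closed, the limits stay inside.\<close>

lemma unit_fraction_series_with_prescribed_tails:
  fixes lo hi :: "nat \<Rightarrow> real" and M :: "nat \<Rightarrow> nat"
  assumes ne: "\<And>n. lo n \<le> hi n" and nonneg: "\<And>n. 0 \<le> lo n"
    and lim: "hi \<longlonglongrightarrow> 0"
    and step: "\<And>n r. r \<in> {lo (Suc n)..hi (Suc n)} \<Longrightarrow> \<exists>b\<in>{1..M n}. r + 1 / real b \<in> {lo n..hi n}"
  obtains b :: "nat \<Rightarrow> nat" and s
    where "\<And>n. 1 \<le> b n" "\<And>n. s n \<in> {lo n..hi n}" "\<And>n. (\<lambda>k. 1 / real (b (n + k))) sums s n"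
proof -
  have "\<exists>f x. (\<forall>i. f i \<le> M i) \<and> (\<forall>i\<in>{0..<0 + N}. 1 \<le> f i) \<and> x \<in> {lo (0 + N)..hi (0 + N)} \<and>
      (\<forall>j\<in>{0..0 + N}. x + (\<Sum>i=j..<0 + N. 1 / real (f i)) \<in> {lo j..hi j})" for N
    using ne step by (rule finite_backward_chain)
  then have "\<forall>N. \<exists>f x. (\<forall>i. f i \<le> M i) \<and> (\<forall>i<N. 1 \<le> f i) \<and> x \<in> {lo N..hi N} \<and>
      (\<forall>j\<le>N. x + (\<Sum>i=j..<N. 1 / real (f i)) \<in> {lo j..hi j})"
    by (simp only: add_0 atLeast0LessThan atLeast0AtMost Ball_def lessThan_iff atMost_iff) simp
  then obtain f x where "\<forall>N. (\<forall>i. f N i \<le> M i) \<and> (\<forall>i<N. 1 \<le> f N i) \<and> x N \<in> {lo N..hi N} \<and>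
      (\<forall>j\<le>N. x N + (\<Sum>i=j..<N. 1 / real (f N i)) \<in> {lo j..hi j})"
    unfolding choice_iff by (elim exE)
  then have f: "\<And>N i. f N i \<le> M i" "\<And>N i. i < N \<Longrightarrow> 1 \<le> f N i"
    and x: "\<And>N. x N \<in> {lo N..hi N}"
    and S: "\<And>N j. j \<le> N \<Longrightarrow> x N + (\<Sum>i=j..<N. 1 / real (f N i)) \<in> {lo j..hi j}"
    by blast+
  obtain g where g: "\<And>m. infinite {N. \<forall>n<m. f N n = g n}"
    using konig_bounded_sequences[of f M, OF f(1)] by blast
  have ex: "\<exists>N>m. \<forall>n<m. f N n = g n" for m
    using g[of m] unfolding infinite_nat_iff_unbounded by auto
  have g1: "1 \<le> g n" for n
    using ex[of "Suc n"] f(2) by (metis lessI less_trans)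
  \<comment> \<open>In a chain that agrees with \<open>g\<close> below \<open>m\<close>, this sum is
    the remainder at \<open>j\<close> minus the remainder at \<open>m\<close>, and the latter lies
    between 0 and \<open>hi m\<close>.\<close>
  have tail: "(\<Sum>i=j..<m. 1 / real (g i)) \<in> {lo j - hi m..hi j}" if "j \<le> m" for j m
  proof -
    obtain N where N: "m < N" "\<forall>n<m. f N n = g n" using ex by blast
    have "(\<Sum>i=j..<N. 1 / real (f N i)) = (\<Sum>i=j..<m. 1 / real (g i)) + (\<Sum>i=m..<N. 1 / real (f N i))"
      using sum.atLeastLessThan_concat[of j m N "\<lambda>i. 1 / real (f N i)"] N that by simp
    moreover have "x N + (\<Sum>i=j..<N. 1 / real (f N i)) \<in> {lo j..hi j}"
      and "x N + (\<Sum>i=m..<N. 1 / real (f N i)) \<in> {lo m..hi m}"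
      using S[of j N] S[of m N] N that by auto
    ultimately show ?thesis using nonneg[of m] by auto
  qed
  have shift: "(\<Sum>k<m. 1 / real (g (n + k))) = (\<Sum>i=n..<n + m. 1 / real (g i))" for n m
    using sum.shift_bounds_nat_ivl[of "\<lambda>i. 1 / real (g i)" 0 n m]
    by (simp add: atLeast0LessThan add.commute)
  have "\<exists>s. s \<in> {lo n..hi n} \<and> (\<lambda>k. 1 / real (g (n + k))) sums s" for n
  proof -
    have "summable (\<lambda>k. 1 / real (g (n + k)))"
      using tail[of n] by (intro summableI_nonneg_bounded[of _ "hi n"]) (auto simp: shift)
    then obtain s where s: "(\<lambda>k. 1 / real (g (n + k))) sums s" by (auto simp: summable_def)
    then have conv: "(\<lambda>m. \<Sum>i=n..<n + m. 1 / real (g i)) \<longlonglongrightarrow> s" by (simp add: sums_def shift)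
    have "s \<le> hi n" using tail[of n] by (intro LIMSEQ_le_const2[OF conv]) auto
    moreover have "(\<lambda>m. lo n - hi (n + m)) \<longlonglongrightarrow> lo n - 0"
      using LIMSEQ_ignore_initial_segment[OF lim, of n]
      by (intro tendsto_intros) (simp add: add.commute)
    then have "lo n \<le> s" using tail[of n] LIMSEQ_le[OF _ conv] by fastforce
    ultimately show ?thesis using s by auto
  qed
  then obtain s where "\<And>n. s n \<in> {lo n..hi n} \<and> (\<lambda>k. 1 / real (g (n + k))) sums s n" by metis
  then show ?thesis using that[of g s] g1 by blast
qed

section \<open>Moving one interval into the preceding one\<close>

text \<open>One \<open>b\<close> with \<open>1 / b \<le> d / 2\<close> serves every
  \<open>r\<close>: it uses up at most half of the upper margin, while the lower end only gains
  room.\<close>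

lemma add_unit_fraction_same_interval:
  fixes d l h :: real
  assumes "0 < d"
  shows "\<exists>M::nat. \<forall>r\<in>{l + d..h - d}. \<exists>b\<in>{1..M}. r + 1 / real b \<in> {l + d / 2..h - d / 2}"
proof -
  obtain B :: nat where B: "2 / d < real B" using reals_Archimedean2 by blast
  have B0: "0 < B" using B assms by (metis divide_pos_pos less_trans of_nat_0_less_iff zero_less_numeral)
  have "1 / real B \<le> d / 2" using B B0 assms by (simp add: field_simps)
  moreover have "0 \<le> 1 / real B" by simp
  ultimately have "r + 1 / real B \<in> {l + d / 2..h - d / 2}" if "r \<in> {l + d..h - d}" for r
    using that assms unfolding atLeastAtMost_iff by argo
  moreover have "B \<in> {1..B}" using B0 by simp
  ultimately show ?thesis by blast
qed

text \<open>Rounding the gap \<open>u\<close> between \<open>r\<close> and the upper end down to a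
  unit fraction loses at most \<open>q u\<close>. As \<open>r\<close> is at least
  \<open>1 / c\<close>, the gap stays below \<open>v < w\<close>, so the loss falls short of the
  interval length \<open>q w\<close> by a fixed amount, which pays for the margins.\<close>

lemma add_unit_fraction_jump:
  fixes a c :: nat
  assumes a: "2 \<le> a" and ac: "a < c"
  shows "\<exists>(d::real) M::nat. 0 < d \<and> 1 / real a + d \<le> 1 / (real a - 1) - d \<and>
    (\<forall>r\<in>{1 / real c..1 / (real c - 1)}. \<exists>b\<in>{1..M}.
        r + 1 / real b \<in> {1 / real a + d..1 / (real a - 1) - d})"
proof -
  define w where "w = 1 / (real a - 1)"
  define v where "v = w - 1 / real c"
  have w0: "0 < w" using a by (simp add: w_def)
  have wa: "w / (1 + w) = 1 / real a" using a by (simp add: w_def field_simps)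
  have v0: "0 \<le> v" using a ac by (simp add: v_def w_def field_simps)
  have "v < w" using ac by (simp add: v_def)
  (* x - x / (1 + x) = x^2 / (1 + x) is the possible loss when x is rounded down to a unit
     fraction; at x = w it equals the length of the interval. *)
  define q where "q x = x - x / (1 + x)" for x :: real
  have q: "q x = x - 1 + 1 / (1 + x)" if "0 \<le> x" for x using that by (simp add: q_def field_simps)
  have q_less: "q x < q y" if "0 \<le> x" "x < y" for x y
  proof -
    have "1 / (1 + x) - 1 / (1 + y) = (y - x) / ((1 + x) * (1 + y))"
      using that by (simp add: field_simps)
    also have "\<dots> < (y - x) / 1"
    proof (rule divide_strict_left_mono)
      have "(1 + x) * (1 + y) = 1 + x + y + x * y" by (simp add: algebra_simps)
      moreover have "0 \<le> x * y" using that by simp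
      ultimately show "1 < (1 + x) * (1 + y)" using that by linarith
    qed (use that in auto)
    finally show ?thesis using q that by simp
  qed
  \<comment> \<open>The surplus \<open>q w - q v\<close> is split equally between the two
    ends.\<close>
  define d where "d = (q w - q v) / 2"
  have d0: "0 < d" using q_less[OF v0 \<open>v < w\<close>] by (simp add: d_def)
  have qv0: "0 \<le> q v" using q_less[of 0 v] v0 by (cases "v = 0") (auto simp: q_def)
  have qw: "q w = w - 1 / real a" by (simp add: q_def wa)
  have len: "1 / real a + d \<le> w - d" using qv0 qw unfolding d_def by argo
  \<comment> \<open>A positive lower bound for the gap \<open>w - d - r\<close>, since
    \<open>r\<close> is at most \<open>1 / a\<close>; it makes the bound \<open>M\<close>
    independent of \<open>r\<close>.\<close>
  define e where "e = w - d - 1 / real a"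
  have e0: "0 < e" using len d0 by (simp add: e_def)
  define M where "M = nat \<lceil>1 / e\<rceil>"
  have "\<exists>b\<in>{1..M}. r + 1 / real b \<in> {1 / real a + d..w - d}"
    if r: "r \<in> {1 / real c..1 / (real c - 1)}" for r
  proof -
    have "1 / (real c - 1) \<le> 1 / real a" using a ac by (intro divide_left_mono) auto
    then have ra: "r \<le> 1 / real a" using r by auto
    define u where "u = w - d - r"
    have ue: "e \<le> u" using ra by (simp add: u_def e_def)
    then have u0: "0 < u" using e0 by simp
    have uv: "u < v" using r d0 by (simp add: u_def v_def)
    \<comment> \<open>The least \<open>b\<close> with \<open>1 / b \<le> u\<close>; as
      \<open>b < 1 / u + 1\<close>, the fraction \<open>1 / b\<close> is at least
      \<open>u / (1 + u) = u - q u\<close>.\<close>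
    define b where "b = nat \<lceil>1 / u\<rceil>"
    have ub: "1 / u \<le> real b" unfolding b_def by linarith
    have iu: "0 < 1 / u" using u0 by simp
    then have bu: "real b < 1 / u + 1" unfolding b_def by linarith
    have b0: "0 < real b" using ub iu by linarith
    have "1 / u \<le> 1 / e" using ue e0 by (intro divide_left_mono) auto
    then have bM: "b \<le> M" unfolding b_def M_def by (intro nat_mono ceiling_mono)
    have up: "1 / real b \<le> u" using ub u0 b0 by (simp add: field_simps)
    have "u / (1 + u) = 1 / (1 / u + 1)" using u0 by (simp add: field_simps)
    also have "\<dots> \<le> 1 / real b" using bu b0 by (intro divide_left_mono) auto
    finally have "u - q u \<le> 1 / real b" by (simp add: q_def)
    moreover have "q u \<le> q v" using q_less[of u v] u0 uv by simp
    ultimately have "1 / real a + d \<le> r + 1 / real b"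
      using qw unfolding u_def d_def by argo
    then show ?thesis using up bM b0 by (intro bexI[of _ b]) (auto simp: u_def)
  qed
  then show ?thesis using d0 len unfolding w_def by blast
qed

section \<open>Choice of the margins and assembly\<close>

theorem theorem1:
  fixes a :: "nat \<Rightarrow> nat"
  assumes "\<And>n. n \<ge> 1 \<Longrightarrow> a n > 0"
    and "mono_on {1..} a"
    and "a 1 \<ge> 2"
    and "filterlim a at_top sequentially"
  shows "\<exists>(\<theta>::real) (b :: nat \<Rightarrow> nat).
           0 < \<theta> \<and> \<theta> < 1 \<and>
           (\<forall>n\<ge>1. b n > 0) \<and>
           (\<lambda>k. 1 / real (b (Suc k))) sums \<theta> \<and>
           (\<forall>n\<ge>1. int (a n) = G (\<theta> - (\<Sum>i=1..n-1. 1 / real (b i))))"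
proof -
  define A where "A n = a (Suc n)" for n
  have mono: "A m \<le> A n" if "m \<le> n" for m n
    using monotone_onD[OF assms(2)] that by (simp add: A_def)
  have A2: "2 \<le> A n" for n using mono[of 0 n] assms(3) by (simp add: A_def)
  have Alim: "filterlim A at_top sequentially"
    using filterlim_compose[OF assms(4) filterlim_Suc] unfolding A_def .
  \<comment> \<open>The whole unshrunk interval at \<open>Suc n\<close> is to be moved, so the
    margin at a jump can be chosen without knowing the later margins.\<close>
  define P where "P n d M \<longleftrightarrow> 0 < d \<and> 1 / real (A n) + d \<le> 1 / (real (A n) - 1) - d \<and>
    (\<forall>r\<in>{1 / real (A (Suc n))..1 / (real (A (Suc n)) - 1)}. \<exists>b\<in>{1..M}.
        r + 1 / real b \<in> {1 / real (A n) + d..1 / (real (A n) - 1) - d})" for n d and M :: nat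
  \<comment> \<open>The implication allows a choice for all \<open>n\<close>; \<open>J n\<close> is
    meaningful only where \<open>A\<close> jumps.\<close>
  have "\<exists>d. A n < A (Suc n) \<longrightarrow> (\<exists>M. P n d M)" for n
    using add_unit_fraction_jump[OF A2, of n "A (Suc n)"] unfolding P_def by blast
  then obtain J where J: "\<And>n. A n < A (Suc n) \<Longrightarrow> \<exists>M. P n (J n) M" by metis
  have jump: "\<exists>m\<ge>n. A m < A (Suc m)" for n
  proof (rule ccontr)
    assume "\<not> ?thesis"
    then have le: "\<And>m. n \<le> m \<Longrightarrow> A (Suc m) \<le> A m" by (meson not_le)
    have "A m \<le> A n" if "n \<le> m" for m
      using that by (induction rule: dec_induct) (use le order_trans in blast)+
    moreover have "\<forall>\<^sub>F m in sequentially. n \<le> m \<and> Suc (A n) \<le> A m"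
      using Alim eventually_ge_at_top[of n] by (simp add: filterlim_at_top eventually_conj)
    then obtain m where "n \<le> m" "Suc (A n) \<le> A m"
      unfolding eventually_sequentially by blast
    ultimately show False using not_less_eq_eq by blast
  qed
  \<comment> \<open>The first jump at or after \<open>n\<close>; \<open>A\<close> is constant from
    \<open>n\<close> up to and including \<open>e n\<close>.\<close>
  define e where "e n = (LEAST m. n \<le> m \<and> A m < A (Suc m))" for n
  have e: "n \<le> e n" "A (e n) < A (Suc (e n))" for n
    using LeastI_ex[OF jump[of n]] unfolding e_def by blast+
  have e_min: "\<not> A m < A (Suc m)" if "n \<le> m" "m < e n" for m n
    using that not_less_Least unfolding e_def by blast
  have e_jump: "e n = n" if "A n < A (Suc n)" for n
    using e(1) e_min[of n n] that by (metis le_neq_implies_less order_refl)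
  have e_stay: "e n = e (Suc n)" if "\<not> A n < A (Suc n)" for n
  proof -
    have "(n \<le> m \<and> A m < A (Suc m)) = (Suc n \<le> m \<and> A m < A (Suc m))" for m
      using that by (auto simp: le_less Suc_le_eq)
    then show ?thesis unfolding e_def by simp
  qed
  have A_e: "A (e n) = A n" for n
  proof -
    have "A m = A n" if "n \<le> m" "m \<le> e n" for m
      using that
    proof (induction rule: dec_induct)
      case (step m)
      then have "A (Suc m) \<le> A m" using e_min[of n m] by simp
      then show ?case using step mono[of m "Suc m"] by simp
    qed simp
    then show ?thesis using e(1) by blast
  qed

  \<comment> \<open>The margin at the jump is halved once for every step back from it, so
    \<open>d n = d (Suc n) / 2\<close> whenever \<open>A (Suc n) = A n\<close>.\<close>
  define d where "d n = J (e n) / 2 ^ (e n - n)" for n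
  define lo where "lo n = 1 / real (A n) + d n" for n
  define hi where "hi n = 1 / (real (A n) - 1) - d n" for n
  have Je: "0 < J (e n)" "1 / real (A n) + J (e n) \<le> 1 / (real (A n) - 1) - J (e n)" for n
    using J[OF e(2)[of n]] unfolding P_def A_e by auto
  have d0: "0 < d n" for n using Je(1) by (simp add: d_def)
  have "d n \<le> J (e n)" for n
    using Je(1)[of n] by (simp add: d_def divide_le_eq)
  then have ne: "lo n \<le> hi n" for n using Je(2)[of n] unfolding lo_def hi_def by (smt (verit))
  have step: "\<exists>M::nat. \<forall>r\<in>{lo (Suc n)..hi (Suc n)}. \<exists>b\<in>{1..M}. r + 1 / real b \<in> {lo n..hi n}" for n
  proof (cases "A n < A (Suc n)")
    case True
    then obtain M where "P n (d n) M" using J[OF True] e_jump[OF True] by (auto simp: d_def)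
    moreover have "{lo (Suc n)..hi (Suc n)} \<subseteq> {1 / real (A (Suc n))..1 / (real (A (Suc n)) - 1)}"
      using d0[of "Suc n"] by (auto simp: lo_def hi_def)
    ultimately show ?thesis unfolding P_def lo_def hi_def by blast
  next
    case False
    then have AS: "A (Suc n) = A n" using mono[of n "Suc n"] by simp
    have "e n - n = Suc (e n - Suc n)" using e(1)[of "Suc n"] e_stay[OF False] by simp
    then have dS: "d n = d (Suc n) / 2" using e_stay[OF False] by (simp add: d_def)
    show ?thesis using add_unit_fraction_same_interval[OF d0] unfolding lo_def hi_def AS dS .
  qed
  then obtain M :: "nat \<Rightarrow> nat" where M:
    "\<And>n r. r \<in> {lo (Suc n)..hi (Suc n)} \<Longrightarrow> \<exists>b\<in>{1..M n}. r + 1 / real b \<in> {lo n..hi n}" by metis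
  have lo0: "0 < lo n" for n using d0[of n] by (simp add: lo_def add_nonneg_pos)
  have lim: "hi \<longlonglongrightarrow> 0"
  proof (rule tendsto_sandwich[of "\<lambda>_. 0"])
    have "filterlim (\<lambda>n. - 1 + real (A n)) at_top sequentially"
      using filterlim_compose[OF filterlim_real_sequentially Alim]
      by (intro filterlim_tendsto_add_at_top[OF tendsto_const])
    then show "(\<lambda>n. 1 / (- 1 + real (A n))) \<longlonglongrightarrow> 0"
      by (intro tendsto_divide_0[OF tendsto_const] filterlim_at_top_imp_at_infinity)
    show "\<forall>\<^sub>F n in sequentially. hi n \<le> 1 / (- 1 + real (A n))"
      using d0 by (simp add: hi_def less_imp_le)
    show "\<forall>\<^sub>F n in sequentially. 0 \<le> hi n"
      using lo0 ne by (intro always_eventually) (meson less_imp_le order_trans)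
  qed simp
  obtain \<beta> :: "nat \<Rightarrow> nat" and s where \<beta>: "\<And>n. 1 \<le> \<beta> n"
    and s: "\<And>n. s n \<in> {lo n..hi n}" and sums: "\<And>n. (\<lambda>k. 1 / real (\<beta> (n + k))) sums s n"
    using unit_fraction_series_with_prescribed_tails[of lo hi M, OF ne less_imp_le[OF lo0] lim M]
    by blast

  \<comment> \<open>The positive margins turn the closed bounds into strict ones; \<open>G\<close>
    requires strictness at the lower end.\<close>
  have s_bounds: "1 / real (A n) < s n" "s n < 1 / (real (A n) - 1)" "s n < 1" for n
  proof -
    show "1 / real (A n) < s n" and less: "s n < 1 / (real (A n) - 1)"
      using s[of n] d0[of n] by (auto simp: lo_def hi_def)
    have "1 / (real (A n) - 1) \<le> 1" using A2[of n] by simp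
    then show "s n < 1" using less by linarith
  qed
  have s_pos: "0 < s n" for n using s[of n] lo0[of n] by auto
  \<comment> \<open>Back to counting from 1: the remainder after the terms \<open>b 1\<close> to
    \<open>b n\<close> is \<open>s n\<close>.\<close>
  define b where "b n = \<beta> (n - 1)" for n
  have tail: "s 0 - (\<Sum>i=1..n. 1 / real (b i)) = s n" for n
  proof -
    have "(\<Sum>i=1..n. 1 / real (b i)) = (\<Sum>i<n. 1 / real (\<beta> i))"
      by (rule sum.reindex_bij_witness[of _ Suc "\<lambda>i. i - 1"]) (auto simp: b_def)
    moreover have "(\<lambda>k. 1 / real (\<beta> (n + k))) sums (s 0 - (\<Sum>i<n. 1 / real (\<beta> i)))"
      using sums_split_initial_segment[OF sums[of 0], of n] by (simp add: add.commute)
    ultimately show ?thesis using sums_unique2[OF sums[of n]] by simp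
  qed
  have "int (a n) = G (s 0 - (\<Sum>i=1..n-1. 1 / real (b i)))" if "1 \<le> n" for n
  proof -
    have "a n = A (n - 1)" using that by (simp add: A_def)
    moreover have "G (s (n - 1)) = int (A (n - 1))"
      using s_bounds[of "n - 1"] s_pos[of "n - 1"] A2[of "n - 1"] by (subst G_eq_iff) auto
    ultimately show ?thesis using tail[of "n - 1"] by simp
  qed
  moreover have "(\<lambda>k. 1 / real (b (Suc k))) sums s 0" using sums[of 0] by (simp add: b_def)
  moreover have "b n > 0" for n using \<beta>[of "n - 1"] by (simp add: b_def)
  ultimately show ?thesis using s_pos[of 0] s_bounds(3)[of 0]
    by (intro exI[of _ "s 0"] exI[of _ b]) simp
qed

end
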